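(* (i) Let $\beta\geq0$ and $\nu>-\frac{1}{2}$. Then, for all $x\geq0$, $$\frac{\mathrm{e}^{-\beta x}K_{\nu+1}(x)}{x^\nu}\int_0^x \mathrm{e}^{\beta t}t^{\nu+1}I_\nu(t)\,\mathrm{d}t< \frac{1}{2}, \qquad \frac{\mathrm{e}^{-\beta x}K_{\nu}(x)}{x^\nu}\int_0^x \mathrm{e}^{\beta t}t^{\nu+1}I_\nu(t)\,\mathrm{d}t< \frac{1}{2}.$$ (ii) Let $\beta\geq0$ and $\nu>-\frac{1}{2}$. Then, for all $x\geq0$, $$\frac{\mathrm{e}^{-\beta x}K_{\nu+1}(x)}{x^{\nu-1}}\int_0^x \mathrm{e}^{\beta t}t^{\nu}I_\nu(t)\,\mathrm{d}t< \frac{\nu+1}{2\nu+1}, \qquad \frac{\mathrm{e}^{-\beta x}K_{\nu}(x)}{x^{\nu-1}}\int_0^x \mathrm{e}^{\beta t}t^{\nu}I_\nu(t)\,\mathrm{d}t< \frac{\nu+1}{2\nu+1}.$$ (iii) Let $-1<\beta<0$ and $\nu>-\frac{1}{2}$. Then, for all $x\geq0$, $$\frac{\mathrm{e}^{-\beta x}K_{\nu+1}(x)}{x^\nu}\int_0^x \mathrm{e}^{\beta t}t^{\nu+1}I_\nu(t)\,\mathrm{d}t< \frac{1}{2(1+\beta)}, \qquad \frac{\mathrm{e}^{-\beta x}K_{\nu}(x)}{x^\nu}\int_0^x \mathrm{e}^{\beta t}t^{\nu+1}I_\nu(t)\,\mathrm{d}t< \frac{1}{2(1+\beta)}.$$ (iv)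 Let $-1<\beta<0$ and $\nu\geq\frac{1}{2}$. Then, for all $x\geq0$, $$\frac{\mathrm{e}^{-\beta x}K_{\nu+1}(x)}{x^{\nu-1}}\int_0^x \mathrm{e}^{\beta t}t^{\nu}I_\nu(t)\,\mathrm{d}t< \frac{\nu+1}{(2\nu+1)(1+\beta)}, \qquad \frac{\mathrm{e}^{-\beta x}K_{\nu}(x)}{x^{\nu-1}}\int_0^x \mathrm{e}^{\beta t}t^{\nu}I_\nu(t)\,\mathrm{d}t< \frac{\nu+1}{(2\nu+1)(1+\beta)}.$$
   Context: $I_\nu$ and $K_\nu$ denote the modified Bessel functions of the first and second kind of real order $\nu$. At $x=0$ each expression on a left-hand side is understood as its limit as $x\downarrow0$. *)

theory Defs
  imports "HOL-Analysis.Analysis"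
begin

(* Used for x > 0 only. At x = 0 the convention 0 powr a = 0 yields the value 0, which is not the
   value of I_0 there; this single point does not affect any of the integrals below. rGamma is the
   entire function 1/Gamma, so that every real order, negative integers included, is covered. *)
definition bessel_I :: "real \<Rightarrow> real \<Rightarrow> real" where
  "bessel_I \<nu> x =
     (\<Sum>k. rGamma (\<nu> + real k + 1) / fact k * (x / 2) powr (\<nu> + 2 * real k))"

definition bessel_K_nonint :: "real \<Rightarrow> real \<Rightarrow> real" where
  "bessel_K_nonint \<nu> x = pi / 2 * (bessel_I (- \<nu>) x - bessel_I \<nu> x) / sin (\<nu> * pi)"

(* Used for x > 0 only. At integer orders, where the quotient above is 0/0, K is its limit in the
   order; "at" is the punctured neighbourhood filter. *)
definition bessel_K :: "real \<Rightarrow> real \<Rightarrow> real" where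
  "bessel_K \<nu> x =
     (if \<nu> \<in> \<int> then Lim (at \<nu>) (\<lambda>\<mu>. bessel_K_nonint \<mu> x) else bessel_K_nonint \<nu> x)"

(* "f x < c for all x >= 0", the value at x = 0 being understood as the limit of f x as x tends to 0
   from the right, whose existence is part of the claim. *)
definition less_on_nonneg :: "(real \<Rightarrow> real) \<Rightarrow> real \<Rightarrow> bool" where
  "less_on_nonneg f c \<longleftrightarrow>
     (\<forall>x>0. f x < c) \<and> (\<exists>L. (f \<longlongrightarrow> L) (at_right 0) \<and> L < c)"

end

theory Submission
  imports Defs "HOL-Probability.Distributions" "HOL-Real_Asymp.Real_Asymp"
begin

text \<open>
  All eight inequalities reduce to one: $x I_\mu(x) K_\mu(x) < 1/2$ for $\mu \ge 1/2$ and $x > 0$, applied with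
  $\mu = \nu + 1$. Indeed, for $p \in \{\nu, \nu+1\}$ and a suitable constant $C$ the function
  $2C\,e^{\beta t}t^pI_{\nu+1}(t)$ vanishes at the origin and has a derivative at least as large as the integrand
  $e^{\beta t}t^pI_\nu(t)$, so it dominates the integral; after multiplication by $e^{-\beta x}K_{\nu+1}(x)/x^{p-1}$
  the bound becomes $2C\,xI_{\nu+1}(x)K_{\nu+1}(x) < C$, and $K_\nu \le K_{\nu+1}$ covers the other order. That the
  derivative is large enough rests on two comparisons of neighbouring orders: the recurrence
  gives $2(\nu+1)I_{\nu+1}/t \le I_\nu$, and \<open>bessel_I_ratio\<close> gives
  $(1 + (\nu+1/2)/t)I_{\nu+1} < I_\nu$. The restriction $\nu \ge 1/2$ for negative $\beta$ and $p = \nu$ is what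
  makes the latter at least as strong as $(1 + 1/t)I_{\nu+1} \le I_\nu$.

  The product bound \<open>bessel_IK_less_half\<close> follows from the Wronskian
  $x(K_\mu I_{\mu-1} + K_{\mu-1}I_\mu) = 1$ once $I_{\mu-1}/I_\mu > 1 + (\mu-1/2)/x$ and
  $K_{\mu-1}/K_\mu \ge 1 - (\mu-1/2)/x$ are known. Each of these is a monotonicity argument for a first-order linear
  equation, started at the origin for $I$ and at infinity for $K$.

  Facts about $I_\nu$ come from its power series. Facts about $K_\nu$ (sign, monotonicity in the order, boundedness
  at infinity) are invisible in its definition as a quotient of $I_{-\nu} - I_\nu$ by a sine, but evident from the
  integral $\frac12\int e^{\nu y - x\cosh y}\,dy$ over the real line. Theorem \<open>bessel_K_eq_integral\<close>
  identifies the two. For $0 < \nu < 1$ the integral is pinned down by conserved quantities of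
  first-order systems that are evaluated at the origin through the Gamma function; the recurrence in the order
  extends this to all noninteger orders, and continuity in the order to the integers.
\<close>

section \<open>The modified Bessel function of the first kind\<close>

definition bessel_coeff :: "real \<Rightarrow> nat \<Rightarrow> real" where
  "bessel_coeff \<nu> k = rGamma (\<nu> + real k + 1) / fact k"

text \<open>
  The entire function $E_\nu$ with $I_\nu(x) = (x/2)^\nu E_\nu((x/2)^2)$. Splitting off the power isolates the
  only singular factor of $I_\nu$ at the origin; $E_\nu$ is the
  regularized hypergeometric function ${}_0F_1(;\nu+1;s)$.
\<close>

definition bessel_E :: "real \<Rightarrow> real \<Rightarrow> real" where
  "bessel_E \<nu> s = (\<Sum>k. bessel_coeff \<nu> k * s ^ k)"

lemma bessel_coeff_Suc:
  "bessel_coeff \<nu> k = (\<nu> + real k + 1) * (real k + 1) * bessel_coeff \<nu> (Suc k)"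
  using rGamma_plus1[of "\<nu> + real k + 1"]
  by (simp add: bessel_coeff_def add_ac divide_simps)

text \<open>
  Consecutive coefficients have ratio $1/((\nu+k+1)(k+1))$. As soon as $k \ge |\nu|$ the first factor
  is at least $1$ in absolute value, whatever the sign of $\nu$, so the second one alone beats any fixed $s$.
\<close>

lemma summable_bessel_coeff: "summable (\<lambda>k. bessel_coeff \<nu> k * s ^ k)"
proof -
  obtain N :: nat where N: "\<bar>\<nu>\<bar> + 2 * \<bar>s\<bar> \<le> real N"
    using real_arch_simple by blast
  show ?thesis
  proof (rule summable_ratio_test[where c = "1/2" and N = N])
    fix n assume "N \<le> n"
    then have n: "\<bar>\<nu>\<bar> + 2 * \<bar>s\<bar> \<le> real n" using N by linarith
    have "2 * \<bar>s\<bar> \<le> 1 * (real n + 1)" using n by (smt (verit))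
    also have "\<dots> \<le> \<bar>\<nu> + real n + 1\<bar> * (real n + 1)"
      using n by (intro mult_right_mono) linarith+
    finally have "2 * \<bar>s\<bar> \<le> \<bar>\<nu> + real n + 1\<bar> * (real n + 1)" .
    then have "2 * \<bar>s\<bar> * \<bar>bessel_coeff \<nu> (Suc n)\<bar> * \<bar>s\<bar> ^ n \<le>
        \<bar>\<nu> + real n + 1\<bar> * (real n + 1) * \<bar>bessel_coeff \<nu> (Suc n)\<bar> * \<bar>s\<bar> ^ n"
      by (intro mult_right_mono) auto
    also have "\<dots> = \<bar>bessel_coeff \<nu> n\<bar> * \<bar>s\<bar> ^ n"
      by (subst (2) bessel_coeff_Suc) (simp add: abs_mult)
    finally show "norm (bessel_coeff \<nu> (Suc n) * s ^ Suc n)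
        \<le> 1/2 * norm (bessel_coeff \<nu> n * s ^ n)"
      by (simp add: abs_mult power_abs mult_ac)
  qed simp
qed

text \<open>
  Differentiating a coefficient cancels one factor of $k!$ and shifts the argument of $1/\Gamma$, so
  $E_\nu' = E_{\nu+1}$ holds without any exceptional orders.
\<close>

lemma has_field_derivative_bessel_E [derivative_intros]:
  assumes "(g has_field_derivative g') (at x within A)"
  shows "((\<lambda>x. bessel_E \<nu> (g x)) has_field_derivative bessel_E (\<nu> + 1) (g x) * g') (at x within A)"
proof -
  have "diffs (bessel_coeff \<nu>) = bessel_coeff (\<nu> + 1)"
    by (rule ext) (simp add: diffs_def bessel_coeff_def add_ac divide_simps)
  then have "(bessel_E \<nu> has_field_derivative bessel_E (\<nu> + 1) (g x)) (at (g x))"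
    using termdiffs_strong_converges_everywhere[OF summable_bessel_coeff, of \<nu> "g x"]
    by (simp add: bessel_E_def[abs_def])
  from DERIV_chain2[OF this assms] show ?thesis .
qed

lemma isCont_bessel_E: "isCont (bessel_E \<nu>) s"
  using has_field_derivative_bessel_E[OF DERIV_ident] DERIV_isCont by blast

text \<open>
  This is $z/\Gamma(z+1) = 1/\Gamma(z)$ read off coefficientwise, with $z = \nu+k+1 = (\nu+1) + k$: the
  summand $k$ cancels against $k!$ and so produces the shifted series $s\,E_{\nu+2}$.
\<close>

lemma bessel_E_recurrence:
  "bessel_E \<nu> s = (\<nu> + 1) * bessel_E (\<nu> + 1) s + s * bessel_E (\<nu> + 2) s"
proof -
  define g where "g k = bessel_coeff \<nu> k * s ^ k - (\<nu> + 1) * (bessel_coeff (\<nu> + 1) k * s ^ k)" for k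
  have g: "summable g"
    unfolding g_def by (intro summable_diff summable_mult summable_bessel_coeff)
  have "g 0 = 0"
    using rGamma_plus1[of "\<nu> + 1"] by (simp add: g_def bessel_coeff_def add_ac)
  moreover have "g (Suc k) = s * (bessel_coeff (\<nu> + 2) k * s ^ k)" for k
  proof -
    have "rGamma (\<nu> + real (Suc k) + 1) = (\<nu> + real k + 2) * rGamma (\<nu> + real k + 3)"
      using rGamma_plus1[of "\<nu> + real k + 2"] by (simp add: add_ac)
    then have "bessel_coeff \<nu> (Suc k) - (\<nu> + 1) * bessel_coeff (\<nu> + 1) (Suc k) = bessel_coeff (\<nu> + 2) k"
      by (simp add: bessel_coeff_def add_ac divide_simps) (simp add: algebra_simps)
    then show ?thesis by (simp add: g_def algebra_simps)
  qed
  ultimately have "suminf g = (\<Sum>k. s * (bessel_coeff (\<nu> + 2) k * s ^ k))"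
    using suminf_split_head[OF g] by simp
  also have "\<dots> = s * bessel_E (\<nu> + 2) s"
    by (simp add: bessel_E_def suminf_mult summable_bessel_coeff)
  also have "suminf g = bessel_E \<nu> s - (\<nu> + 1) * bessel_E (\<nu> + 1) s"
    unfolding g_def bessel_E_def
    by (subst suminf_diff[symmetric])
      (auto intro!: summable_mult summable_bessel_coeff simp: suminf_mult summable_bessel_coeff)
  finally show ?thesis by simp
qed

lemma bessel_E_0: "bessel_E \<nu> 0 = rGamma (\<nu> + 1)"
  unfolding bessel_E_def by (subst powser_zero) (simp add: bessel_coeff_def)

lemma bessel_E_pos:
  assumes "\<nu> > -1" "s \<ge> 0"
  shows "bessel_E \<nu> s > 0"
  unfolding bessel_E_def
proof (rule suminf_pos2[OF summable_bessel_coeff, where i = 0])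
  have "bessel_coeff \<nu> k > 0" for k
    using assms by (simp add: bessel_coeff_def rGamma_inverse_Gamma)
  then show "0 \<le> bessel_coeff \<nu> n * s ^ n" "0 < bessel_coeff \<nu> 0 * s ^ 0" for n
    using assms by (simp_all add: less_imp_le)
qed

lemma bessel_I_eq_bessel_E:
  assumes "x \<ge> 0"
  shows "bessel_I \<nu> x = (x / 2) powr \<nu> * bessel_E \<nu> ((x / 2)\<^sup>2)"
proof (cases "x = 0")
  case False
  then have "(x / 2) powr (2 * real k) = ((x / 2)\<^sup>2) ^ k" for k
    using assms powr_realpow[of "x / 2" "2 * k"] by (simp add: power_mult)
  then show ?thesis
    unfolding bessel_I_def bessel_E_def
    by (subst suminf_mult[OF summable_bessel_coeff, symmetric])
      (simp add: bessel_coeff_def powr_add mult_ac)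
qed (simp add: bessel_I_def)

lemma bessel_I_pos: "\<nu> > -1 \<Longrightarrow> x > 0 \<Longrightarrow> bessel_I \<nu> x > 0"
  by (simp add: bessel_I_eq_bessel_E bessel_E_pos)

lemma bessel_I_nonneg: "\<nu> > -1 \<Longrightarrow> x \<ge> 0 \<Longrightarrow> bessel_I \<nu> x \<ge> 0"
  by (simp add: bessel_I_eq_bessel_E bessel_E_pos less_imp_le)

lemma bessel_I_recurrence:
  assumes "x > 0"
  shows "bessel_I (\<nu> - 1) x - bessel_I (\<nu> + 1) x = 2 * \<nu> / x * bessel_I \<nu> x"
proof -
  have "bessel_I (\<nu> - 1) x = (x / 2) powr \<nu> * (2 / x) * bessel_E (\<nu> - 1) ((x / 2)\<^sup>2)"
    using assms by (simp add: bessel_I_eq_bessel_E powr_diff)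
  also have "\<dots> = (x / 2) powr \<nu> * (2 / x) *
      (\<nu> * bessel_E \<nu> ((x / 2)\<^sup>2) + (x / 2)\<^sup>2 * bessel_E (\<nu> + 1) ((x / 2)\<^sup>2))"
    using bessel_E_recurrence[of "\<nu> - 1" "(x / 2)\<^sup>2"] by (simp add: add_ac)
  also have "\<dots> = 2 * \<nu> / x * bessel_I \<nu> x + bessel_I (\<nu> + 1) x"
    using assms by (simp add: bessel_I_eq_bessel_E powr_add field_simps power2_eq_square)
  finally show ?thesis by simp
qed

text \<open>
  Every derivative of a Bessel function is needed in two forms, expressed by the neighbour of order
  $\nu+1$ or by that of order $\nu-1$, so that a pair of neighbouring orders satisfies a closed first-order system.
\<close>

lemma has_field_derivative_bessel_I_up:
  assumes "x > 0"
  shows "(bessel_I \<nu> has_field_derivative \<nu> / x * bessel_I \<nu> x + bessel_I (\<nu> + 1) x) (at x)"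
proof -
  have "((\<lambda>x. (x / 2) powr \<nu> * bessel_E \<nu> ((x / 2)\<^sup>2)) has_field_derivative
      \<nu> / x * bessel_I \<nu> x + bessel_I (\<nu> + 1) x) (at x)"
    using assms
    by (auto intro!: derivative_eq_intros
        simp: bessel_I_eq_bessel_E powr_add powr_diff field_simps power2_eq_square)
  moreover have "\<forall>\<^sub>F y in nhds x. bessel_I \<nu> y = (y / 2) powr \<nu> * bessel_E \<nu> ((y / 2)\<^sup>2)"
    using assms eventually_nhds_in_open[of "{0<..}" x]
    by (auto elim!: eventually_mono simp: bessel_I_eq_bessel_E)
  ultimately show ?thesis
    by (subst DERIV_cong_ev[OF refl _ refl]) auto
qed

lemma has_field_derivative_bessel_I_down:
  assumes "x > 0"
  shows "(bessel_I \<nu> has_field_derivative bessel_I (\<nu> - 1) x - \<nu> / x * bessel_I \<nu> x) (at x)"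
  using has_field_derivative_bessel_I_up[OF assms, of \<nu>] bessel_I_recurrence[OF assms, of \<nu>]
  by (simp add: algebra_simps)

text \<open>
  The leading behaviour at the origin, for every real order; it evaluates all the conserved
  quantities below.
\<close>

lemma tendsto_bessel_I_at_0:
  "((\<lambda>x. x powr (- \<nu>) * bessel_I \<nu> x) \<longlongrightarrow> 2 powr (- \<nu>) * rGamma (\<nu> + 1)) (at_right 0)"
proof -
  have "((\<lambda>x. bessel_E \<nu> ((x / 2)\<^sup>2)) \<longlongrightarrow> bessel_E \<nu> 0) (at_right 0)"
    by (rule isCont_tendsto_compose[OF isCont_bessel_E]) (auto intro!: tendsto_eq_intros)
  then have "((\<lambda>x. 2 powr (- \<nu>) * bessel_E \<nu> ((x / 2)\<^sup>2)) \<longlongrightarrow> 2 powr (- \<nu>) * rGamma (\<nu> + 1)) (at_right 0)"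
    by (auto intro: tendsto_mult_left simp: bessel_E_0)
  then show ?thesis
    by (rule Lim_transform_eventually)
      (auto intro!: eventually_mono[OF eventually_at_right_less]
        simp: bessel_I_eq_bessel_E powr_divide powr_minus field_simps)
qed


section \<open>The integral for the modified Bessel function of the second kind\<close>

text \<open>
  The symmetric form over the whole line of the classical representation
  $K_\nu(x) = \int_0^\infty e^{-x\cosh y}\cosh(\nu y)\,dy$. With the pure exponential $e^{\nu y}$ the order shifts
  $\nu \pm 1$ are multiplications by $e^{\pm y}$.
\<close>

definition bessel_K_integral :: "real \<Rightarrow> real \<Rightarrow> real" where
  "bessel_K_integral \<nu> x = (\<integral>y. exp (\<nu> * y - x * cosh y) \<partial>lborel) / 2"

lemma measurable_bessel_K_kernel [measurable]:
  "(\<lambda>y::real. exp (\<nu> * y - x * cosh y)) \<in> borel_measurable borel"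
  by (intro borel_measurable_continuous_onI continuous_intros)

lemma square_le_cosh: "y\<^sup>2 / 4 \<le> cosh (y::real)"
proof -
  have "y\<^sup>2 / 2 \<le> exp \<bar>y\<bar>"
    using exp_lower_Taylor_quadratic[of "\<bar>y\<bar>"] abs_ge_zero[of y] by simp
  also have "\<dots> \<le> 2 * cosh \<bar>y\<bar>"
    by (simp add: cosh_field_def)
  finally show ?thesis by simp
qed

text \<open>
  After $\cosh y \ge y^2/4$ and completing the square, the kernel lies below a multiple of the normal
  density with mean $2\nu/x$ and variance $2/x$.
\<close>

lemma integrable_bessel_K_kernel:
  fixes \<nu> x :: real
  assumes "x > 0"
  shows "integrable lborel (\<lambda>y. exp (\<nu> * y - x * cosh y))"
proof (rule Bochner_Integration.integrable_bound)
  define C where "C = exp (\<nu>\<^sup>2 / x) * sqrt (2 * pi * (2 / x))"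
  show "integrable lborel (\<lambda>y. C * normal_density (2 * \<nu> / x) (sqrt (2 / x)) y)"
    using assms by (intro integrable_mult_right integrable_normal_density) simp
  show "AE y in lborel. norm (exp (\<nu> * y - x * cosh y))
      \<le> norm (C * normal_density (2 * \<nu> / x) (sqrt (2 / x)) y)"
  proof (rule AE_I2)
    fix y :: real
    have "exp (\<nu> * y - x * cosh y) \<le> exp (\<nu> * y - x * (y\<^sup>2 / 4))"
      using assms square_le_cosh[of y] by simp
    also have "\<nu> * y - x * (y\<^sup>2 / 4) = \<nu>\<^sup>2 / x + - (y - 2 * \<nu> / x)\<^sup>2 / (2 * (2 / x))"
      using assms by (simp add: field_simps power2_eq_square)
    also have "exp \<dots> = C * normal_density (2 * \<nu> / x) (sqrt (2 / x)) y"
      using assms by (simp add: C_def normal_density_def flip: exp_add)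
    finally show "norm (exp (\<nu> * y - x * cosh y))
        \<le> norm (C * normal_density (2 * \<nu> / x) (sqrt (2 / x)) y)"
      by simp
  qed
qed simp

text \<open>
  Dominated convergence along a continuous parameter; it is used for differentiation in $x$, for
  continuity in the order, and for the limit $x \downarrow 0$.
\<close>

lemma integral_tendsto_at_within:
  fixes F :: "real \<Rightarrow> real \<Rightarrow> real"
  assumes "integrable lborel w"
    and bound: "\<And>s y. s \<in> S \<Longrightarrow> s \<noteq> l \<Longrightarrow> \<bar>F s y\<bar> \<le> w y"
    and "\<And>s. F s \<in> borel_measurable borel" "G \<in> borel_measurable borel"
    and lim: "\<And>y. ((\<lambda>s. F s y) \<longlongrightarrow> G y) (at l within S)"
  shows "((\<lambda>s. \<integral>y. F s y \<partial>lborel) \<longlongrightarrow> (\<integral>y. G y \<partial>lborel)) (at l within S)"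
  unfolding tendsto_at_iff_sequentially comp_def
proof (intro allI impI)
  fix X assume X: "\<forall>i::nat. X i \<in> S - {l}" "X \<longlonglongrightarrow> l"
  show "(\<lambda>i. \<integral>y. F (X i) y \<partial>lborel) \<longlonglongrightarrow> (\<integral>y. G y \<partial>lborel)"
  proof (rule integral_dominated_convergence[where w = w])
    show "AE y in lborel. (\<lambda>i. F (X i) y) \<longlonglongrightarrow> G y"
      using lim X unfolding tendsto_at_iff_sequentially comp_def by auto
    show "AE y in lborel. norm (F (X i) y) \<le> w y" for i
      using bound X by auto
  qed (use assms in simp_all)
qed

lemma bessel_K_integral_nonneg: "bessel_K_integral \<nu> x \<ge> 0"
  by (simp add: bessel_K_integral_def integral_nonneg_AE)

lemma bessel_K_integral_minus: "bessel_K_integral (- \<nu>) x = bessel_K_integral \<nu> x"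
  unfolding bessel_K_integral_def
  by (subst lborel_integral_real_affine[where c = "-1" and t = 0]) simp_all

text \<open>
  Averaging the orders $\nu$ and $-\nu$ turns the factor $e^{\nu y}$ into $\cosh(\nu y)$, which increases
  with $|\nu|$ pointwise.
\<close>

lemma bessel_K_integral_mono_order:
  assumes "x > 0" "\<bar>\<nu>\<bar> \<le> a"
  shows "bessel_K_integral \<nu> x \<le> bessel_K_integral a x"
proof -
  have eq: "cosh (\<mu> * y) * exp (- x * cosh y)
      = (exp (\<mu> * y - x * cosh y) + exp (- \<mu> * y - x * cosh y)) / 2" for \<mu> y
    by (simp add: cosh_field_def[of "\<mu> * y"] distrib_right flip: exp_add)
  have k: "integrable lborel (\<lambda>y. exp (\<mu> * y - x * cosh y))" for \<mu>
    using assms(1) by (rule integrable_bessel_K_kernel)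
  have int: "integrable lborel (\<lambda>y. cosh (\<mu> * y) * exp (- x * cosh y))" for \<mu>
    unfolding eq by (intro integrable_divide Bochner_Integration.integrable_add k)
  have sym: "bessel_K_integral \<mu> x = (\<integral>y. cosh (\<mu> * y) * exp (- x * cosh y) \<partial>lborel) / 2" for \<mu>
  proof -
    have "(\<integral>y. cosh (\<mu> * y) * exp (- x * cosh y) \<partial>lborel)
        = bessel_K_integral \<mu> x + bessel_K_integral (- \<mu>) x"
      unfolding eq integral_divide_zero bessel_K_integral_def
      by (subst Bochner_Integration.integral_add[OF k k]) (rule add_divide_distrib)
    then show ?thesis by (simp add: bessel_K_integral_minus)
  qed
  have "cosh (\<nu> * y) \<le> cosh (a * y)" for y
  proof -
    have "cosh (\<nu> * y) = cosh (\<bar>\<nu>\<bar> * \<bar>y\<bar>)"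
      by (metis abs_mult cosh_real_abs)
    also have "\<dots> \<le> cosh (a * \<bar>y\<bar>)"
      using assms(2) by (subst cosh_real_nonneg_le_iff) (auto intro!: mult_right_mono)
    also have "\<dots> = cosh (a * y)"
      by (cases "y \<ge> 0") auto
    finally show ?thesis .
  qed
  then show ?thesis
    unfolding sym by (intro divide_right_mono integral_mono int mult_right_mono) auto
qed

lemma bessel_K_integral_antimono:
  assumes "0 < x" "x \<le> x'"
  shows "bessel_K_integral \<nu> x' \<le> bessel_K_integral \<nu> x"
  unfolding bessel_K_integral_def using assms
  by (intro divide_right_mono integral_mono integrable_bessel_K_kernel)
    (auto intro!: mult_right_mono cosh_real_nonneg)

text \<open>
  Integration by parts: the derivative of $e^{\nu y - x\cosh y}$ is $(\nu - x\sinh y)$ times itself, and its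
  integral over the line vanishes.
\<close>

lemma bessel_K_integral_recurrence:
  assumes "x > 0"
  shows "bessel_K_integral (\<nu> + 1) x - bessel_K_integral (\<nu> - 1) x
    = 2 * \<nu> / x * bessel_K_integral \<nu> x"
proof -
  define F where "F y = exp (\<nu> * y - x * cosh y)" for y :: real
  define f where "f y = \<nu> * exp (\<nu> * y - x * cosh y)
      - x / 2 * (exp ((\<nu> + 1) * y - x * cosh y) - exp ((\<nu> - 1) * y - x * cosh y))" for y :: real
  have f: "integrable lborel f"
    unfolding f_def using assms
    by (intro Bochner_Integration.integrable_diff integrable_mult_right integrable_bessel_K_kernel)
  have deriv: "(F has_field_derivative f y) (at y)" for y
  proof -
    have "f y = (\<nu> - x * sinh y) * F y"
      by (simp add: f_def F_def sinh_field_def algebra_simps add_divide_distrib diff_divide_distrib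
          flip: exp_add)
    moreover have "(F has_field_derivative (\<nu> - x * sinh y) * F y) (at y)"
      unfolding F_def by (auto intro!: derivative_eq_intros)
    ultimately show ?thesis by simp
  qed
  have le: "F y \<le> exp (\<nu> * y - x * (y\<^sup>2 / 4))" for y
    using assms square_le_cosh[of y] by (simp add: F_def)
  have squeeze: "(F \<longlongrightarrow> 0) A" if "((\<lambda>y. exp (\<nu> * y - x * (y\<^sup>2 / 4))) \<longlongrightarrow> 0) A" for A
  proof (rule tendsto_sandwich[OF _ _ tendsto_const that])
    show "\<forall>\<^sub>F y in A. 0 \<le> F y" by (simp add: F_def)
    show "\<forall>\<^sub>F y in A. F y \<le> exp (\<nu> * y - x * (y\<^sup>2 / 4))"
      by (rule always_eventually) (use le in blast)
  qed
  have "((\<lambda>y. exp (\<nu> * y - x * (y\<^sup>2 / 4))) \<longlongrightarrow> 0) at_top"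
       "((\<lambda>y. exp (\<nu> * y - x * (y\<^sup>2 / 4))) \<longlongrightarrow> 0) at_bot"
    using assms by real_asymp+
  then have lim: "(F \<longlongrightarrow> 0) at_top" "(F \<longlongrightarrow> 0) at_bot"
    by (auto intro: squeeze)
  have "(LBINT y=-\<infinity>..\<infinity>. f y) = 0 - 0"
  proof (rule interval_integral_FTC_integrable)
    show "(F has_vector_derivative f y) (at y)" for y
      using deriv has_real_derivative_iff_has_vector_derivative by blast
    show "isCont f y" for y
      unfolding f_def by (intro continuous_intros)
    show "set_integrable lborel (einterval (-\<infinity>) \<infinity>) f"
      using f by (simp add: set_integrable_def)
  qed (use lim in \<open>simp_all add: ereal_tendsto_simps\<close>)
  then have "0 = (\<integral>y. f y \<partial>lborel)"
    by (simp add: interval_lebesgue_integral_def set_lebesgue_integral_def)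
  also have "\<dots> = \<nu> * (2 * bessel_K_integral \<nu> x)
      - x / 2 * (2 * bessel_K_integral (\<nu> + 1) x - 2 * bessel_K_integral (\<nu> - 1) x)"
    unfolding f_def bessel_K_integral_def using assms
    by (simp add: integrable_bessel_K_kernel)
  finally show ?thesis
    using assms by (simp add: field_simps)
qed

lemma abs_exp_diff_le:
  fixes p q M :: real
  assumes "p \<le> M" "q \<le> M"
  shows "\<bar>exp p - exp q\<bar> \<le> \<bar>p - q\<bar> * exp M"
proof -
  have *: "exp p - exp q \<le> (p - q) * exp M" if "q \<le> p" "p \<le> M" for p q :: real
  proof -
    have "exp p - exp q = (1 - exp (q - p)) * exp p"
      by (simp add: algebra_simps flip: exp_add)
    also have "\<dots> \<le> (p - q) * exp M"
      using exp_ge_add_one_self[of "q - p"] that by (intro mult_mono) (simp_all add: algebra_simps)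
    finally show ?thesis .
  qed
  show ?thesis
    using *[of p q] *[of q p] assms by (cases "q \<le> p") (auto simp: abs_if)
qed

text \<open>
  Differentiating under the integral brings down $-\cosh y$, that is, $-(K_{\nu+1}+K_{\nu-1})/2$; the
  recurrence then eliminates $K_{\nu+1}$.
\<close>

lemma has_field_derivative_bessel_K_integral:
  assumes "x > 0"
  shows "(bessel_K_integral \<nu> has_field_derivative
    - bessel_K_integral (\<nu> - 1) x - \<nu> / x * bessel_K_integral \<nu> x) (at x)"
proof -
  define k where "k \<mu> s y = exp (\<mu> * y - s * cosh y)" for \<mu> s y :: real
  have k: "integrable lborel (k \<mu> s)" if "s > 0" for \<mu> s
    using integrable_bessel_K_kernel[OF that] by (simp add: k_def[abs_def])
  define q where "q h = (bessel_K_integral \<nu> (x + h) - bessel_K_integral \<nu> x) / h" for h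
  \<comment> \<open>On this neighbourhood the arguments x + h stay above x / 2, which gives a dominating function.\<close>
  define S where "S = {- (x / 2)<..<x / 2}"
  have S: "at 0 within S = at 0"
    using assms by (intro at_within_open) (auto simp: S_def)
  have cosh_k: "cosh y * k \<nu> s y = (k (\<nu> + 1) s y + k (\<nu> - 1) s y) / 2" for s y
    by (simp add: k_def cosh_field_def field_simps flip: exp_add)
  have "((\<lambda>h. \<integral>y. (k \<nu> (x + h) y - k \<nu> x y) / h \<partial>lborel) \<longlongrightarrow>
      (\<integral>y. - cosh y * k \<nu> x y \<partial>lborel)) (at 0 within S)"
  proof (rule integral_tendsto_at_within)
    show "integrable lborel (\<lambda>y. cosh y * k \<nu> (x / 2) y)"
      unfolding cosh_k using assms by (intro integrable_divide Bochner_Integration.integrable_add k) auto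
    fix h y assume h: "h \<in> S" "h \<noteq> 0"
    have "\<bar>k \<nu> (x + h) y - k \<nu> x y\<bar> \<le> \<bar>(\<nu> * y - (x + h) * cosh y) - (\<nu> * y - x * cosh y)\<bar> * k \<nu> (x / 2) y"
      unfolding k_def using h assms
      by (intro abs_exp_diff_le) (auto simp: S_def intro!: mult_right_mono cosh_real_nonneg)
    also have "\<dots> = \<bar>h\<bar> * (cosh y * k \<nu> (x / 2) y)"
      by (simp add: algebra_simps abs_mult)
    finally show "\<bar>(k \<nu> (x + h) y - k \<nu> x y) / h\<bar> \<le> cosh y * k \<nu> (x / 2) y"
      using h by (simp add: abs_divide divide_le_eq mult.commute)
  next
    fix y
    have "((\<lambda>s. k \<nu> s y) has_field_derivative - cosh y * k \<nu> x y) (at x)"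
      unfolding k_def by (auto intro!: derivative_eq_intros)
    then show "((\<lambda>h. (k \<nu> (x + h) y - k \<nu> x y) / h) \<longlongrightarrow> - cosh y * k \<nu> x y) (at 0 within S)"
      by (simp add: DERIV_def S)
  qed (auto simp: k_def intro!: borel_measurable_continuous_onI continuous_intros)
  moreover have "(\<integral>y. - cosh y * k \<nu> x y \<partial>lborel)
      = - (bessel_K_integral (\<nu> + 1) x + bessel_K_integral (\<nu> - 1) x)"
    using k assms by (simp add: cosh_k bessel_K_integral_def add_divide_distrib flip: k_def)
  moreover have "\<forall>\<^sub>F h in at 0 within S. (\<integral>y. (k \<nu> (x + h) y - k \<nu> x y) / h \<partial>lborel)
      = 2 * ((bessel_K_integral \<nu> (x + h) - bessel_K_integral \<nu> x) / h)"
    unfolding eventually_at_filter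
  proof (intro always_eventually allI impI)
    fix h assume "h \<in> S"
    then have "x + h > 0" using assms by (auto simp: S_def)
    then show "(\<integral>y. (k \<nu> (x + h) y - k \<nu> x y) / h \<partial>lborel)
      = 2 * ((bessel_K_integral \<nu> (x + h) - bessel_K_integral \<nu> x) / h)"
      using k assms by (simp add: bessel_K_integral_def Bochner_Integration.integral_diff diff_divide_distrib flip: k_def)
  qed
  ultimately have "((\<lambda>h. 2 * q h) \<longlongrightarrow>
      - (bessel_K_integral (\<nu> + 1) x + bessel_K_integral (\<nu> - 1) x)) (at 0)"
    by (simp only: S tendsto_cong q_def)
  from tendsto_mult_left[OF this, of "1/2"]
  have "(q \<longlongrightarrow> - (bessel_K_integral (\<nu> + 1) x + bessel_K_integral (\<nu> - 1) x) / 2) (at 0)"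
    by simp
  then have "(bessel_K_integral \<nu> has_field_derivative
      - (bessel_K_integral (\<nu> + 1) x + bessel_K_integral (\<nu> - 1) x) / 2) (at x)"
    by (simp add: DERIV_def q_def[abs_def])
  moreover have "- (bessel_K_integral (\<nu> + 1) x + bessel_K_integral (\<nu> - 1) x) / 2
      = - bessel_K_integral (\<nu> - 1) x - \<nu> / x * bessel_K_integral \<nu> x"
    using bessel_K_integral_recurrence[OF assms, of \<nu>] by (simp add: field_simps)
  ultimately show ?thesis by (rule DERIV_cong)
qed

text \<open>
  Continuity in the order is what identifies the limit that defines $K_n$ for integer $n$.
\<close>

lemma tendsto_bessel_K_integral_order:
  assumes "x > 0"
  shows "((\<lambda>\<mu>. bessel_K_integral \<mu> x) \<longlongrightarrow> bessel_K_integral \<nu> x) (at \<nu>)"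
proof -
  define S where "S = {\<nu> - 1<..<\<nu> + 1}"
  have S: "at \<nu> within S = at \<nu>"
    by (intro at_within_open) (auto simp: S_def)
  have "((\<lambda>\<mu>. \<integral>y. exp (\<mu> * y - x * cosh y) \<partial>lborel) \<longlongrightarrow>
      (\<integral>y. exp (\<nu> * y - x * cosh y) \<partial>lborel)) (at \<nu> within S)"
  proof (rule integral_tendsto_at_within)
    show "integrable lborel (\<lambda>y. exp ((\<nu> + 1) * y - x * cosh y) + exp ((\<nu> - 1) * y - x * cosh y))"
      using assms by (intro Bochner_Integration.integrable_add integrable_bessel_K_kernel)
    fix \<mu> y assume "\<mu> \<in> S" "\<mu> \<noteq> \<nu>"
    then have "\<mu> * y \<le> (\<nu> + 1) * y \<or> \<mu> * y \<le> (\<nu> - 1) * y"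
      by (cases "y \<ge> 0") (auto simp: S_def intro: mult_right_mono mult_right_mono_neg)
    then have "exp (\<mu> * y - x * cosh y) \<le> exp ((\<nu> + 1) * y - x * cosh y)
        \<or> exp (\<mu> * y - x * cosh y) \<le> exp ((\<nu> - 1) * y - x * cosh y)"
      by auto
    moreover have "0 \<le> exp ((\<nu> + 1) * y - x * cosh y)" "0 \<le> exp ((\<nu> - 1) * y - x * cosh y)"
      by simp_all
    ultimately show "\<bar>exp (\<mu> * y - x * cosh y)\<bar>
        \<le> exp ((\<nu> + 1) * y - x * cosh y) + exp ((\<nu> - 1) * y - x * cosh y)"
      unfolding abs_exp_cancel by linarith
  qed (auto intro!: tendsto_intros)
  then show ?thesis
    unfolding bessel_K_integral_def S by (intro tendsto_divide tendsto_const) auto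
qed

text \<open>
  Euler's integral for $\Gamma(\nu)$ after the substitution $t = e^z/2$.
\<close>

lemma Gamma_integral_exp:
  assumes "\<nu> > 0"
  shows "integrable lborel (\<lambda>z::real. exp (\<nu> * z - exp z / 2))"
    and "(\<integral>z. exp (\<nu> * z - exp z / 2) \<partial>lborel) = 2 powr \<nu> * Gamma \<nu>"
proof -
  define f where "f t = t powr (\<nu> - 1) / exp t" for t :: real
  define g where "g z = exp z / 2" for z :: real
  have g: "g ` UNIV = {0<..}"
  proof (intro equalityI subsetI)
    fix t :: real assume "t \<in> {0<..}"
    then have "t = g (ln (2 * t))" by (simp add: g_def)
    then show "t \<in> range g" by blast
  qed (auto simp: g_def)
  have int: "(f has_integral Gamma \<nu>) {0<..}"
  proof -
    have "((\<lambda>t. if t \<in> {0<..} then f t else 0) has_integral Gamma \<nu>) {0..}"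
      by (rule has_integral_spike[of "{0}", OF _ _ Gamma_integral_real[OF assms]]) (auto simp: f_def)
    also have "?this \<longleftrightarrow> ?thesis"
      by (subst has_integral_restrict) auto
    finally show ?thesis .
  qed
  then have "f absolutely_integrable_on {0<..}"
    by (intro nonnegative_absolutely_integrable_1) (auto simp: f_def has_integral_integrable)
  with int g have "f absolutely_integrable_on (g ` UNIV) \<and> integral (g ` UNIV) f = Gamma \<nu>"
    by (simp add: integral_unique)
  then have *: "(\<lambda>z. \<bar>g z\<bar> * f (g z)) absolutely_integrable_on UNIV \<and>
      integral UNIV (\<lambda>z. \<bar>g z\<bar> * f (g z)) = Gamma \<nu>"
    by (subst has_absolute_integral_change_of_variables_1'[where g = g])
      (auto simp: g_def[abs_def] inj_on_def intro!: derivative_eq_intros)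
  have eq: "\<bar>g z\<bar> * f (g z) = 2 powr (- \<nu>) * exp (\<nu> * z - exp z / 2)" for z
  proof -
    have "\<bar>g z\<bar> * f (g z) = g z powr \<nu> / exp (g z)"
      by (simp add: f_def g_def powr_diff)
    also have "g z powr \<nu> = 2 powr (- \<nu>) * exp (\<nu> * z)"
      by (simp add: g_def powr_divide powr_minus exp_powr_real field_simps)
    finally show ?thesis by (simp add: g_def exp_diff)
  qed
  have meas: "(\<lambda>z::real. exp (\<nu> * z - exp z / 2)) \<in> borel_measurable borel"
    by measurable
  have "(\<lambda>z. 2 powr \<nu> * (\<bar>g z\<bar> * f (g z))) absolutely_integrable_on UNIV"
    using * by (intro set_integrable_mult_right) auto
  then have "(\<lambda>z::real. exp (\<nu> * z - exp z / 2)) absolutely_integrable_on UNIV"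
    by (simp add: eq powr_minus)
  then show int: "integrable lborel (\<lambda>z::real. exp (\<nu> * z - exp z / 2))"
    using meas by (simp add: set_integrable_def integrable_completion)
  have "Gamma \<nu> = 2 powr (- \<nu>) * integral UNIV (\<lambda>z::real. exp (\<nu> * z - exp z / 2))"
    using * by (simp add: eq)
  also have "integral UNIV (\<lambda>z::real. exp (\<nu> * z - exp z / 2))
      = (\<integral>z. exp (\<nu> * z - exp z / 2) \<partial>lborel)"
    using int by (rule integral_lborel)
  finally show "(\<integral>z. exp (\<nu> * z - exp z / 2) \<partial>lborel) = 2 powr \<nu> * Gamma \<nu>"
    by (simp add: powr_minus field_simps)
qed

text \<open>
  The shift $y = z - \ln x$ absorbs $x^\nu$ and turns $x\cosh y$ into $e^z/2 + x^2e^{-z}/2$, whose second part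
  vanishes in the limit; what remains is Euler's integral. Positivity of $\nu$ makes the limiting integrand
  integrable at $z = -\infty$.
\<close>

lemma tendsto_bessel_K_integral_at_0:
  assumes "\<nu> > 0"
  shows "((\<lambda>x. x powr \<nu> * bessel_K_integral \<nu> x) \<longlongrightarrow> 2 powr (\<nu> - 1) * Gamma \<nu>) (at_right 0)"
proof -
  have "((\<lambda>x. \<integral>z. exp (\<nu> * z - exp z / 2 - x\<^sup>2 * exp (- z) / 2) \<partial>lborel) \<longlongrightarrow>
      (\<integral>z. exp (\<nu> * z - exp z / 2) \<partial>lborel)) (at_right 0)"
  proof (rule integral_tendsto_at_within)
    show "((\<lambda>x. exp (\<nu> * z - exp z / 2 - x\<^sup>2 * exp (- z) / 2)) \<longlongrightarrow> exp (\<nu> * z - exp z / 2)) (at_right 0)" for z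
      by (auto intro!: tendsto_eq_intros)
  qed (auto intro!: Gamma_integral_exp assms borel_measurable_continuous_onI continuous_intros)
  moreover have "\<forall>\<^sub>F x in at_right 0.
      (\<integral>z. exp (\<nu> * z - exp z / 2 - x\<^sup>2 * exp (- z) / 2) \<partial>lborel)
      = 2 * (x powr \<nu> * bessel_K_integral \<nu> x)"
    using eventually_at_right_less
  proof (rule eventually_mono)
    fix x :: real assume x: "0 < x"
    have "2 * bessel_K_integral \<nu> x = (\<integral>z. exp (\<nu> * (- ln x + z) - x * cosh (- ln x + z)) \<partial>lborel)"
      unfolding bessel_K_integral_def
      by (subst lborel_integral_real_affine[where c = 1 and t = "- ln x"]) simp_all
    also have "(\<lambda>z. exp (\<nu> * (- ln x + z) - x * cosh (- ln x + z)))
      = (\<lambda>z. x powr (- \<nu>) * exp (\<nu> * z - exp z / 2 - x\<^sup>2 * exp (- z) / 2))"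
    proof
      fix z
      have "x * cosh (- ln x + z) = exp z / 2 + x\<^sup>2 * exp (- z) / 2"
        using x by (simp add: cosh_field_def exp_diff exp_minus field_simps power2_eq_square)
      then show "exp (\<nu> * (- ln x + z) - x * cosh (- ln x + z))
          = x powr (- \<nu>) * exp (\<nu> * z - exp z / 2 - x\<^sup>2 * exp (- z) / 2)"
        using x by (simp add: powr_def algebra_simps flip: exp_add)
    qed
    finally show "(\<integral>z. exp (\<nu> * z - exp z / 2 - x\<^sup>2 * exp (- z) / 2) \<partial>lborel)
      = 2 * (x powr \<nu> * bessel_K_integral \<nu> x)"
      using x by (simp add: powr_minus field_simps)
  qed
  ultimately have "((\<lambda>x. 2 * (x powr \<nu> * bessel_K_integral \<nu> x)) \<longlongrightarrow> 2 powr \<nu> * Gamma \<nu>) (at_right 0)"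
    using Gamma_integral_exp(2)[OF assms] by (simp add: tendsto_cong)
  from tendsto_mult_left[OF this, of "1/2"] show ?thesis
    by (simp add: powr_diff)
qed


section \<open>Wronskians and the identification of the second kind\<close>

lemma eq_limit_at_0_if_derivative_0:
  fixes f :: "real \<Rightarrow> real"
  assumes "\<And>x. x > 0 \<Longrightarrow> (f has_field_derivative 0) (at x)"
    and "(f \<longlongrightarrow> L) (at_right 0)" and "x > 0"
  shows "f x = L"
proof -
  have "\<exists>c. \<forall>x\<in>{0<..}. f x = c"
    by (rule has_field_derivative_zero_constant) (auto intro: has_field_derivative_at_within assms(1))
  then obtain c where c: "\<And>x. x > 0 \<Longrightarrow> f x = c" by auto
  have "((\<lambda>x::real. c) \<longlongrightarrow> L) (at_right 0)"
    using assms(2) by (rule Lim_transform_eventually)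
      (auto intro: eventually_mono[OF eventually_at_right_less] c)
  then have "c = L"
    by (simp add: tendsto_const_iff)
  then show ?thesis using c assms(3) by simp
qed

lemma has_field_derivative_bessel_K_integral_up:
  assumes "x > 0"
  shows "(bessel_K_integral \<nu> has_field_derivative
    \<nu> / x * bessel_K_integral \<nu> x - bessel_K_integral (\<nu> + 1) x) (at x)"
  using has_field_derivative_bessel_K_integral[OF assms, of \<nu>]
    bessel_K_integral_recurrence[OF assms, of \<nu>]
  by (simp add: algebra_simps)

lemma tendsto_powr_at_right_0:
  assumes "(a::real) > 0"
  shows "((\<lambda>x. x powr a) \<longlongrightarrow> 0) (at_right 0)"
  using assms by real_asymp

text \<open>
  The first-order systems for $I$ and $K$ make the left-hand side constant in $x$. As $x \downarrow 0$ the
  first product tends to $2^{\nu-1}\Gamma(\nu) \cdot 2^{1-\nu}/\Gamma(\nu) = 1$, while the second one is negligible.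
\<close>

lemma bessel_wronskian_IK:
  assumes "\<nu> > 0" "x > 0"
  shows "x * (bessel_K_integral \<nu> x * bessel_I (\<nu> - 1) x
    + bessel_K_integral (\<nu> - 1) x * bessel_I \<nu> x) = 1"
proof (rule eq_limit_at_0_if_derivative_0[OF _ _ assms(2)])
  fix x :: real assume x: "x > 0"
  note I' = has_field_derivative_bessel_I_up[OF x, of "\<nu> - 1"] has_field_derivative_bessel_I_down[OF x, of \<nu>]
  note K' = has_field_derivative_bessel_K_integral[OF x, of \<nu>] has_field_derivative_bessel_K_integral_up[OF x, of "\<nu> - 1"]
  show "((\<lambda>x. x * (bessel_K_integral \<nu> x * bessel_I (\<nu> - 1) x
    + bessel_K_integral (\<nu> - 1) x * bessel_I \<nu> x)) has_field_derivative 0) (at x)"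
    by (rule derivative_eq_intros I' K' refl)+ (use x in \<open>simp add: field_simps\<close>)
next
  have "((\<lambda>x. (x powr \<nu> * bessel_K_integral \<nu> x) * (x powr (- (\<nu> - 1)) * bessel_I (\<nu> - 1) x)) \<longlongrightarrow>
      (2 powr (\<nu> - 1) * Gamma \<nu>) * (2 powr (- (\<nu> - 1)) * rGamma (\<nu> - 1 + 1))) (at_right 0)"
    by (intro tendsto_mult tendsto_bessel_K_integral_at_0 tendsto_bessel_I_at_0 assms)
  also have "(2 powr (\<nu> - 1) * Gamma \<nu>) * (2 powr (- (\<nu> - 1)) * rGamma (\<nu> - 1 + 1)) = 1"
    using Gamma_real_pos[OF assms(1)] by (simp add: rGamma_inverse_Gamma powr_diff powr_minus)
  finally have 1: "((\<lambda>x. x * (bessel_K_integral \<nu> x * bessel_I (\<nu> - 1) x)) \<longlongrightarrow> 1) (at_right 0)"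
    by (rule Lim_transform_eventually)
      (auto intro!: eventually_mono[OF eventually_at_right_less] simp: powr_diff powr_minus field_simps)
  \<comment> \<open>Any order a strictly between |nu - 1| and nu + 1 works: K of order nu - 1 lies below K of order a, which is o(x powr (- 1 - nu)).\<close>
  define a where "a = (\<bar>\<nu> - 1\<bar> + (\<nu> + 1)) / 2"
  have a: "a > 0" "\<bar>\<nu> - 1\<bar> \<le> a" "1 + \<nu> - a > 0"
    using assms(1) by (auto simp: a_def abs_if)
  have "((\<lambda>x. x powr (1 + \<nu> - a) * ((x powr a * bessel_K_integral a x) * (x powr (- \<nu>) * bessel_I \<nu> x))) \<longlongrightarrow>
      0 * ((2 powr (a - 1) * Gamma a) * (2 powr (- \<nu>) * rGamma (\<nu> + 1)))) (at_right 0)"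
    by (intro tendsto_mult tendsto_bessel_K_integral_at_0 tendsto_bessel_I_at_0 tendsto_powr_at_right_0 a)
  then have lim: "((\<lambda>x. x * (bessel_K_integral a x * bessel_I \<nu> x)) \<longlongrightarrow> 0) (at_right 0)"
    unfolding mult_zero_left
    by (rule Lim_transform_eventually)
      (auto intro!: eventually_mono[OF eventually_at_right_less] simp: powr_diff powr_add powr_minus field_simps)
  have 2: "((\<lambda>x. x * (bessel_K_integral (\<nu> - 1) x * bessel_I \<nu> x)) \<longlongrightarrow> 0) (at_right 0)"
  proof (rule tendsto_sandwich[OF _ _ tendsto_const lim])
    show "\<forall>\<^sub>F x in at_right 0. 0 \<le> x * (bessel_K_integral (\<nu> - 1) x * bessel_I \<nu> x)"
      using assms(1) by (auto intro!: eventually_mono[OF eventually_at_right_less]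
        mult_nonneg_nonneg bessel_K_integral_nonneg bessel_I_nonneg)
    show "\<forall>\<^sub>F x in at_right 0. x * (bessel_K_integral (\<nu> - 1) x * bessel_I \<nu> x)
        \<le> x * (bessel_K_integral a x * bessel_I \<nu> x)"
      using assms(1) a by (auto intro!: eventually_mono[OF eventually_at_right_less] mult_right_mono
        bessel_K_integral_mono_order bessel_I_nonneg)
  qed
  show "((\<lambda>x. x * (bessel_K_integral \<nu> x * bessel_I (\<nu> - 1) x
    + bessel_K_integral (\<nu> - 1) x * bessel_I \<nu> x)) \<longlongrightarrow> 1) (at_right 0)"
    using tendsto_add[OF 1 2] by (simp add: distrib_left)
qed

lemma rGamma_reflection_real: "rGamma \<nu> * rGamma (1 - \<nu>) = sin (pi * \<nu>) / pi" for \<nu> :: real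
proof -
  have "complex_of_real (rGamma \<nu> * rGamma (1 - \<nu>)) = complex_of_real (sin (pi * \<nu>) / pi)"
    using rGamma_reflection_complex[of "complex_of_real \<nu>"]
    by (simp flip: sin_of_real rGamma_complex_of_real)
  then show ?thesis by (simp only: of_real_eq_iff)
qed

text \<open>
  The analogous conserved quantity for the two solutions $I_\nu$ and $I_{-\nu}$. Its value
  $2/(\Gamma(\nu)\Gamma(1-\nu))$ at the origin is the source of the sine in the definition of $K_\nu$.
\<close>

lemma bessel_wronskian_II:
  assumes "x > 0"
  shows "x * (bessel_I (\<nu> - 1) x * bessel_I (- \<nu>) x - bessel_I (1 - \<nu>) x * bessel_I \<nu> x)
    = 2 * sin (pi * \<nu>) / pi"
proof (rule eq_limit_at_0_if_derivative_0[OF _ _ assms])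
  fix x :: real assume x: "x > 0"
  note I' = has_field_derivative_bessel_I_up[OF x, of "\<nu> - 1", simplified]
    has_field_derivative_bessel_I_up[OF x, of "- \<nu>", simplified]
    has_field_derivative_bessel_I_down[OF x, of \<nu>]
    has_field_derivative_bessel_I_down[OF x, of "1 - \<nu>", simplified]
  show "((\<lambda>x. x * (bessel_I (\<nu> - 1) x * bessel_I (- \<nu>) x - bessel_I (1 - \<nu>) x * bessel_I \<nu> x))
      has_field_derivative 0) (at x)"
    by (rule derivative_eq_intros I' refl)+ (use x in \<open>simp add: field_simps\<close>)
next
  let ?f = "\<lambda>\<mu> x. x powr (- \<mu>) * bessel_I \<mu> x"
  have "((\<lambda>x. ?f (\<nu> - 1) x * ?f (- \<nu>) x - x powr 2 * (?f (1 - \<nu>) x * ?f \<nu> x)) \<longlongrightarrow>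
      (2 powr (- (\<nu> - 1)) * rGamma (\<nu> - 1 + 1)) * (2 powr (- (- \<nu>)) * rGamma (- \<nu> + 1))
      - 0 * ((2 powr (- (1 - \<nu>)) * rGamma (1 - \<nu> + 1)) * (2 powr (- \<nu>) * rGamma (\<nu> + 1)))) (at_right 0)"
    by (intro tendsto_mult tendsto_diff tendsto_bessel_I_at_0 tendsto_powr_at_right_0) simp
  also have "(2 powr (- (\<nu> - 1)) * rGamma (\<nu> - 1 + 1)) * (2 powr (- (- \<nu>)) * rGamma (- \<nu> + 1))
      - 0 * ((2 powr (- (1 - \<nu>)) * rGamma (1 - \<nu> + 1)) * (2 powr (- \<nu>) * rGamma (\<nu> + 1)))
      = 2 * (rGamma \<nu> * rGamma (1 - \<nu>))"
    by (simp add: powr_diff powr_minus)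
  also have "\<dots> = 2 * sin (pi * \<nu>) / pi"
    by (simp add: rGamma_reflection_real)
  finally show "((\<lambda>x. x * (bessel_I (\<nu> - 1) x * bessel_I (- \<nu>) x - bessel_I (1 - \<nu>) x * bessel_I \<nu> x))
      \<longlongrightarrow> 2 * sin (pi * \<nu>) / pi) (at_right 0)"
    by (rule Lim_transform_eventually)
      (auto intro!: eventually_mono[OF eventually_at_right_less]
        simp: powr_diff powr_minus field_simps power2_eq_square)
qed

text \<open>
  For $0 < \nu < 1$ both $\nu$ and $1-\nu$ are positive, so the mixed Wronskian is known for both orders.
  By evenness in the order these are two linear equations for the pair $(K_\nu, K_{1-\nu})$ given by the integral;
  Cramer's rule, with the determinant evaluated by the Wronskian of $I_\nu$ and $I_{-\nu}$, gives the quotient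
  that defines $K_\nu$.
\<close>

lemma bessel_K_nonint_eq_integral_unit:
  assumes "0 < \<nu>" "\<nu> < 1" "x > 0"
  shows "bessel_K_nonint \<nu> x = bessel_K_integral \<nu> x"
proof -
  define K K' where "K = bessel_K_integral \<nu> x" and "K' = bessel_K_integral (\<nu> - 1) x"
  have K': "bessel_K_integral (1 - \<nu>) x = K'"
    using bessel_K_integral_minus[of "\<nu> - 1" x] by (simp add: K'_def)
  have A: "x * (K * bessel_I (\<nu> - 1) x + K' * bessel_I \<nu> x) = 1"
    using bessel_wronskian_IK[of \<nu> x] assms by (simp add: K_def K'_def)
  have B: "x * (K' * bessel_I (- \<nu>) x + K * bessel_I (1 - \<nu>) x) = 1"
    using bessel_wronskian_IK[of "1 - \<nu>" x] assms
    by (simp add: K' bessel_K_integral_minus flip: K_def)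
  have "K * (2 * sin (pi * \<nu>) / pi)
      = K * (x * (bessel_I (\<nu> - 1) x * bessel_I (- \<nu>) x - bessel_I (1 - \<nu>) x * bessel_I \<nu> x))"
    using bessel_wronskian_II[OF assms(3), of \<nu>] by simp
  also have "\<dots> = (x * (K * bessel_I (\<nu> - 1) x + K' * bessel_I \<nu> x)) * bessel_I (- \<nu>) x
      - (x * (K' * bessel_I (- \<nu>) x + K * bessel_I (1 - \<nu>) x)) * bessel_I \<nu> x"
    by (simp add: algebra_simps)
  also have "\<dots> = bessel_I (- \<nu>) x - bessel_I \<nu> x"
    by (simp add: A B)
  finally have "K * (2 * sin (pi * \<nu>) / pi) = bessel_I (- \<nu>) x - bessel_I \<nu> x" .
  moreover have "sin (pi * \<nu>) > 0"
    using assms by (intro sin_gt_zero) auto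
  ultimately show ?thesis
    by (simp add: bessel_K_nonint_def K_def[symmetric] mult.commute[of \<nu>] field_simps)
qed

lemma bessel_K_nonint_minus: "bessel_K_nonint (- \<nu>) x = bessel_K_nonint \<nu> x"
  by (simp add: bessel_K_nonint_def divide_simps) (simp add: algebra_simps)

text \<open>
  The signs of the recurrences for $I_\nu$ and $I_{-\nu}$ are opposite, and a shift of the order by one
  negates the sine, so their quotient inherits the recurrence of the integral.
\<close>

lemma bessel_K_nonint_recurrence:
  assumes "x > 0"
  shows "bessel_K_nonint (\<nu> + 1) x - bessel_K_nonint (\<nu> - 1) x
    = 2 * \<nu> / x * bessel_K_nonint \<nu> x"
proof -
  have s: "sin ((\<nu> + 1) * pi) = - sin (\<nu> * pi)" "sin ((\<nu> - 1) * pi) = - sin (\<nu> * pi)"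
    by (simp_all add: distrib_right left_diff_distrib sin_add sin_diff)
  have minus_order: "- (\<nu> + 1) = - \<nu> - 1" "- (\<nu> - 1) = 1 - \<nu>" by simp_all
  have I: "bessel_I (- \<nu> - 1) x = bessel_I (1 - \<nu>) x - 2 * \<nu> / x * bessel_I (- \<nu>) x"
    "bessel_I (\<nu> - 1) x = bessel_I (\<nu> + 1) x + 2 * \<nu> / x * bessel_I \<nu> x"
    using bessel_I_recurrence[OF assms, of "- \<nu>"] bessel_I_recurrence[OF assms, of \<nu>]
    by (simp_all add: add_ac)
  have "bessel_K_nonint (\<nu> + 1) x - bessel_K_nonint (\<nu> - 1) x
      = - (pi / 2) * ((bessel_I (- \<nu> - 1) x - bessel_I (\<nu> + 1) x)
          - (bessel_I (1 - \<nu>) x - bessel_I (\<nu> - 1) x)) / sin (\<nu> * pi)"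
    unfolding bessel_K_nonint_def s minus_order by (simp add: diff_divide_distrib right_diff_distrib)
  also have "\<dots> = 2 * \<nu> / x * bessel_K_nonint \<nu> x"
    unfolding I bessel_K_nonint_def by (simp add: diff_divide_distrib add_divide_distrib algebra_simps)
  finally show ?thesis .
qed

text \<open>
  Both sides are even in the order and satisfy the same recurrence of second order in it, so agreement on
  $(-1,0)$ and $(0,1)$ propagates to all other intervals between integers.
\<close>

lemma bessel_K_nonint_eq_integral:
  assumes "\<nu> \<notin> \<int>" "x > 0"
  shows "bessel_K_nonint \<nu> x = bessel_K_integral \<nu> x"
proof -
  have *: "bessel_K_nonint \<mu> x = bessel_K_integral \<mu> x"
    if "-1 < \<mu>" "\<mu> < real m + 1" "\<mu> \<notin> \<int>" for m \<mu>
    using that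
  proof (induction m arbitrary: \<mu>)
    case 0
    then have "\<mu> \<noteq> 0" by auto
    then consider "0 < \<mu>" | "0 < - \<mu>" by linarith
    then show ?case
    proof cases
      case 1
      then show ?thesis using 0 assms bessel_K_nonint_eq_integral_unit by simp
    next
      case 2
      then show ?thesis
        using 0 assms bessel_K_nonint_eq_integral_unit[of "- \<mu>" x]
        by (simp add: bessel_K_nonint_minus bessel_K_integral_minus)
    qed
  next
    case (Suc m)
    show ?case
    proof (cases "\<mu> < real m + 1")
      case False
      have "\<mu> \<noteq> 1" using Suc.prems by auto
      with False have \<mu>: "\<mu> > 1" by linarith
      have notint: "\<mu> - 1 \<notin> \<int>" "\<mu> - 2 \<notin> \<int>"
        using Suc.prems(3) Ints_add[of "\<mu> - 1" 1] Ints_add[of "\<mu> - 2" 2] by auto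
      have "bessel_K_nonint (\<mu> - 1) x = bessel_K_integral (\<mu> - 1) x"
        "bessel_K_nonint (\<mu> - 2) x = bessel_K_integral (\<mu> - 2) x"
        using \<mu> Suc.prems notint by (auto intro!: Suc.IH)
      then show ?thesis
        using bessel_K_nonint_recurrence[OF assms(2), of "\<mu> - 1"]
          bessel_K_integral_recurrence[OF assms(2), of "\<mu> - 1"]
        by simp
    qed (use Suc in blast)
  qed
  obtain m :: nat where m: "\<bar>\<nu>\<bar> \<le> real m" using real_arch_simple by blast
  show ?thesis
  proof (cases "\<nu> \<ge> 0")
    case True
    then show ?thesis using *[of \<nu> m] m assms by auto
  next
    case False
    then show ?thesis using *[of "- \<nu>" m] m assms
      by (auto simp: bessel_K_nonint_minus bessel_K_integral_minus)
  qed
qed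

theorem bessel_K_eq_integral:
  assumes "x > 0"
  shows "bessel_K \<nu> x = bessel_K_integral \<nu> x"
proof (cases "\<nu> \<in> \<int>")
  case True
  then obtain n where n: "\<nu> = of_int n" by (elim Ints_cases)
  have "\<forall>\<^sub>F \<mu> in at \<nu>. \<mu> \<in> {\<nu> - 1<..<\<nu> + 1} - {\<nu>}"
    by (intro eventually_at_in_open) auto
  then have "\<forall>\<^sub>F \<mu> in at \<nu>. bessel_K_integral \<mu> x = bessel_K_nonint \<mu> x"
  proof (rule eventually_mono)
    fix \<mu> assume \<mu>: "\<mu> \<in> {\<nu> - 1<..<\<nu> + 1} - {\<nu>}"
    have "\<mu> \<notin> \<int>"
    proof
      assume "\<mu> \<in> \<int>"
      then obtain k where "\<mu> = of_int k" by (elim Ints_cases)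
      with \<mu> n show False by auto
    qed
    then show "bessel_K_integral \<mu> x = bessel_K_nonint \<mu> x"
      using bessel_K_nonint_eq_integral assms by simp
  qed
  with tendsto_bessel_K_integral_order[OF assms]
  have "((\<lambda>\<mu>. bessel_K_nonint \<mu> x) \<longlongrightarrow> bessel_K_integral \<nu> x) (at \<nu>)"
    by (rule Lim_transform_eventually)
  then show ?thesis
    using True by (simp add: bessel_K_def tendsto_Lim)
qed (simp add: bessel_K_def bessel_K_nonint_eq_integral assms)


section \<open>Ratio bounds and the product of the two kinds\<close>

text \<open>
  Let $d$ be the right side minus the left side. The derivative formulas give
  $d' = -(1 + 1/(2t))\,d + (\mu^2 - 1/4)\,I_\mu/t^2$, so $\sqrt{t}\,e^t d$ is nondecreasing for $\mu \ge 1/2$; and $d$ is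
  positive near the origin, where $t^{\mu-1}$ times a positive constant is its leading term. The bound says that
  $\sqrt{x}\,e^{-x}I_\mu(x)$ increases.
\<close>

lemma bessel_I_ratio:
  assumes "\<mu> \<ge> 1/2" "x > 0"
  shows "(1 + (\<mu> - 1/2) / x) * bessel_I \<mu> x < bessel_I (\<mu> - 1) x"
proof -
  define d where "d t = bessel_I (\<mu> - 1) t - (1 + (\<mu> - 1/2) / t) * bessel_I \<mu> t" for t
  define w where "w t = exp (t + ln t / 2)" for t :: real
  have d': "(d has_field_derivative
      - (1 + 1 / (2 * t)) * d t + (\<mu>\<^sup>2 - 1/4) / t\<^sup>2 * bessel_I \<mu> t) (at t)" if t: "t > 0" for t
  proof -
    note I' = has_field_derivative_bessel_I_up[OF t, of "\<mu> - 1"]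
      has_field_derivative_bessel_I_down[OF t, of \<mu>]
    have t0: "t \<noteq> 0" using t by simp
    show ?thesis
      unfolding d_def
      by (rule I' derivative_eq_intros refl t0)+
        (use t in \<open>auto simp: field_simps power2_eq_square\<close>)
  qed
  have w': "(w has_field_derivative (1 + 1 / (2 * t)) * w t) (at t)" if "t > 0" for t
    unfolding w_def using that by (auto intro!: derivative_eq_intros simp: field_simps)
  have wd': "((\<lambda>t. w t * d t) has_field_derivative
      w t * ((\<mu>\<^sup>2 - 1/4) / t\<^sup>2 * bessel_I \<mu> t)) (at t)" if "t > 0" for t
    by (rule DERIV_cong[OF DERIV_mult[OF w' d']]) (use that in \<open>auto simp: algebra_simps\<close>)
  have mu: "\<mu>\<^sup>2 - 1/4 \<ge> 0"
    using power_mono[of "1/2" \<mu> 2] assms(1) by (simp add: power2_eq_square)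
  \<comment> \<open>The limit of t powr (1 - mu) * d t at the origin.\<close>
  have "((\<lambda>t. t powr (- (\<mu> - 1)) * bessel_I (\<mu> - 1) t
        - (t + (\<mu> - 1/2)) * (t powr (- \<mu>) * bessel_I \<mu> t)) \<longlongrightarrow>
      2 powr (- (\<mu> - 1)) * rGamma (\<mu> - 1 + 1) - (0 + (\<mu> - 1/2)) * (2 powr (- \<mu>) * rGamma (\<mu> + 1)))
      (at_right 0)"
    by (intro tendsto_intros tendsto_bessel_I_at_0)
  also have "2 powr (- (\<mu> - 1)) * rGamma (\<mu> - 1 + 1) - (0 + (\<mu> - 1/2)) * (2 powr (- \<mu>) * rGamma (\<mu> + 1))
      = (\<mu> + 1/2) * (2 powr (- \<mu>) * rGamma (\<mu> + 1))"
    using rGamma_plus1[of \<mu>, symmetric] by (simp add: powr_diff powr_minus field_simps)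
  finally have "\<forall>\<^sub>F t in at_right 0. 0 < t powr (- (\<mu> - 1)) * bessel_I (\<mu> - 1) t
        - (t + (\<mu> - 1/2)) * (t powr (- \<mu>) * bessel_I \<mu> t)"
    by (rule order_tendstoD(1)) (use assms in \<open>simp add: rGamma_inverse_Gamma\<close>)
  moreover have "\<forall>\<^sub>F t in at_right 0. t \<in> {0<..<x}"
    using assms(2) by (rule eventually_at_right_real)
  ultimately have "\<forall>\<^sub>F t in at_right 0. 0 < t \<and> t < x \<and> 0 < d t"
  proof eventually_elim
    case (elim t)
    have "t powr (- (\<mu> - 1)) * bessel_I (\<mu> - 1) t
        - (t + (\<mu> - 1/2)) * (t powr (- \<mu>) * bessel_I \<mu> t) = t powr (1 - \<mu>) * d t"
      using elim by (simp add: d_def powr_diff powr_minus field_simps)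
    then have "0 < t powr (1 - \<mu>) * d t" using elim(1) by (simp only:)
    with elim show ?case by (simp add: zero_less_mult_iff)
  qed
  then have "\<exists>t. 0 < t \<and> t < x \<and> 0 < d t"
    by (rule eventually_happens'[OF trivial_limit_at_right_real])
  then obtain t where t: "0 < t" "t < x" "0 < d t" by blast
  have "w t * d t \<le> w x * d x"
  proof (rule DERIV_nonneg_imp_nondecreasing[where f = "\<lambda>t. w t * d t"])
    fix s assume "t \<le> s" "s \<le> x"
    then have s: "s > 0" using t by simp
    show "\<exists>y. ((\<lambda>t. w t * d t) has_field_derivative y) (at s) \<and> y \<ge> 0"
    proof (intro exI conjI)
      show "0 \<le> w s * ((\<mu>\<^sup>2 - 1/4) / s\<^sup>2 * bessel_I \<mu> s)"
        using s mu assms(1) by (intro mult_nonneg_nonneg divide_nonneg_nonneg bessel_I_nonneg) (auto simp: w_def)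
    qed (rule wd'[OF s])
  qed (use t in auto)
  moreover have "0 < w t * d t" using t by (simp add: w_def)
  ultimately have "0 < w x * d x" by linarith
  then have "0 < d x" by (simp add: w_def zero_less_mult_iff)
  then show ?thesis by (simp add: d_def)
qed

text \<open>
  The mirror image of the preceding argument: with $d$ the left side minus the right side,
  $\sqrt{t}\,e^{-t}d$ is nondecreasing, but now its sign is read off at infinity, where it lies below
  $K_\mu(1)\sqrt{t}\,e^{-t}$. The bound says that $\sqrt{x}\,e^{x}K_\mu(x)$ does not increase.
\<close>

lemma bessel_K_integral_ratio:
  assumes "\<mu> \<ge> 1/2" "x > 0"
  shows "(1 - (\<mu> - 1/2) / x) * bessel_K_integral \<mu> x \<le> bessel_K_integral (\<mu> - 1) x"
proof -
  define d where "d t = (1 - (\<mu> - 1/2) / t) * bessel_K_integral \<mu> t - bessel_K_integral (\<mu> - 1) t" for t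
  define w where "w t = exp (- t + ln t / 2)" for t :: real
  have d': "(d has_field_derivative
      (1 - 1 / (2 * t)) * d t + (\<mu>\<^sup>2 - 1/4) / t\<^sup>2 * bessel_K_integral \<mu> t) (at t)" if t: "t > 0" for t
  proof -
    note K' = has_field_derivative_bessel_K_integral[OF t, of \<mu>]
      has_field_derivative_bessel_K_integral_up[OF t, of "\<mu> - 1"]
    have t0: "t \<noteq> 0" using t by simp
    show ?thesis
      unfolding d_def
      by (rule K' derivative_eq_intros refl t0)+
        (use t in \<open>auto simp: field_simps power2_eq_square\<close>)
  qed
  have w': "(w has_field_derivative - (1 - 1 / (2 * t)) * w t) (at t)" if "t > 0" for t
    unfolding w_def using that by (auto intro!: derivative_eq_intros simp: field_simps)
  have wd': "((\<lambda>t. w t * d t) has_field_derivative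
      w t * ((\<mu>\<^sup>2 - 1/4) / t\<^sup>2 * bessel_K_integral \<mu> t)) (at t)" if "t > 0" for t
    by (rule DERIV_cong[OF DERIV_mult[OF w' d']]) (use that in \<open>auto simp: algebra_simps\<close>)
  have mu: "\<mu>\<^sup>2 - 1/4 \<ge> 0"
    using power_mono[of "1/2" \<mu> 2] assms(1) by (simp add: power2_eq_square)
  define C where "C = bessel_K_integral \<mu> 1"
  have le: "w x * d x \<le> C * w t" if t: "t \<ge> max x 1" for t
  proof -
    have "w x * d x \<le> w t * d t"
    proof (rule DERIV_nonneg_imp_nondecreasing[where f = "\<lambda>t. w t * d t"])
      fix s assume "x \<le> s" "s \<le> t"
      then have s: "s > 0" using t assms(2) by simp
      show "\<exists>y. ((\<lambda>t. w t * d t) has_field_derivative y) (at s) \<and> y \<ge> 0"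
      proof (intro exI conjI)
        show "0 \<le> w s * ((\<mu>\<^sup>2 - 1/4) / s\<^sup>2 * bessel_K_integral \<mu> s)"
          using s mu assms(1) by (intro mult_nonneg_nonneg divide_nonneg_nonneg bessel_K_integral_nonneg) (auto simp: w_def)
      qed (rule wd'[OF s])
    qed (use t in auto)
    also have "d t \<le> C"
    proof -
      have "(1 - (\<mu> - 1/2) / t) * bessel_K_integral \<mu> t \<le> 1 * bessel_K_integral \<mu> t"
        using assms t by (intro mult_right_mono bessel_K_integral_nonneg) auto
      moreover have "bessel_K_integral \<mu> t \<le> C"
        unfolding C_def using t by (intro bessel_K_integral_antimono) auto
      ultimately show ?thesis
        using bessel_K_integral_nonneg[of "\<mu> - 1" t] by (simp add: d_def)
    qed
    then have "w t * d t \<le> C * w t" by (simp add: w_def mult.commute)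
    finally show ?thesis .
  qed
  have "((\<lambda>t. C * w t) \<longlongrightarrow> C * 0) at_top"
    unfolding w_def by (intro tendsto_mult tendsto_const) real_asymp
  then have "w x * d x \<le> C * 0"
    by (rule tendsto_lowerbound)
      (auto intro!: eventually_mono[OF eventually_ge_at_top[of "max x 1"]] le)
  then have "d x \<le> 0" by (simp add: w_def mult_le_0_iff)
  then show ?thesis by (simp add: d_def)
qed

text \<open>
  Inserting the two ratio bounds into the Wronskian
  $x(K_\mu I_{\mu-1} + K_{\mu-1}I_\mu) = 1$ makes the correction terms $\pm(\mu-1/2)/x$ cancel, and
  leaves $2xI_\mu K_\mu < 1$.
\<close>

lemma bessel_IK_less_half:
  assumes "\<mu> \<ge> 1/2" "x > 0"
  shows "x * (bessel_I \<mu> x * bessel_K_integral \<mu> x) < 1/2"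
proof (cases "bessel_K_integral \<mu> x = 0")
  case False
  then have K: "bessel_K_integral \<mu> x > 0"
    using bessel_K_integral_nonneg[of \<mu> x] by simp
  have I: "bessel_I \<mu> x > 0"
    using assms by (intro bessel_I_pos) auto
  have "2 * (bessel_I \<mu> x * bessel_K_integral \<mu> x)
      = bessel_K_integral \<mu> x * ((1 + (\<mu> - 1/2) / x) * bessel_I \<mu> x)
      + ((1 - (\<mu> - 1/2) / x) * bessel_K_integral \<mu> x) * bessel_I \<mu> x"
    by (simp add: algebra_simps)
  also have "\<dots> < bessel_K_integral \<mu> x * bessel_I (\<mu> - 1) x + bessel_K_integral (\<mu> - 1) x * bessel_I \<mu> x"
    using bessel_I_ratio[OF assms] bessel_K_integral_ratio[OF assms] K I
    by (intro add_less_le_mono mult_strict_left_mono mult_right_mono) auto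
  finally have "x * (2 * (bessel_I \<mu> x * bessel_K_integral \<mu> x)) < x * (bessel_K_integral \<mu> x
      * bessel_I (\<mu> - 1) x + bessel_K_integral (\<mu> - 1) x * bessel_I \<mu> x)"
    using assms(2) by (rule mult_strict_left_mono)
  also have "\<dots> = 1"
    using assms by (intro bessel_wronskian_IK) auto
  finally show ?thesis by simp
qed simp

lemma tendsto_bessel_IK_at_0:
  assumes "\<mu> > 0"
  shows "((\<lambda>x. x * (bessel_I \<mu> x * bessel_K_integral \<mu> x)) \<longlongrightarrow> 0) (at_right 0)"
proof -
  have "((\<lambda>x. x * ((x powr (- \<mu>) * bessel_I \<mu> x) * (x powr \<mu> * bessel_K_integral \<mu> x))) \<longlongrightarrow>
      0 * ((2 powr (- \<mu>) * rGamma (\<mu> + 1)) * (2 powr (\<mu> - 1) * Gamma \<mu>))) (at_right 0)"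
    by (intro tendsto_mult tendsto_bessel_I_at_0 tendsto_bessel_K_integral_at_0 tendsto_ident_at assms)
  then show ?thesis
    unfolding mult_zero_left
    by (rule Lim_transform_eventually)
      (auto intro!: eventually_mono[OF eventually_at_right_less] simp: powr_minus field_simps)
qed

section \<open>Bounds for the weighted integrals\<close>

text \<open>
  Comparison with an antiderivative $G$ that is continuous up to the endpoints. The integrand $f$ may be
  unbounded at the left endpoint.
\<close>

lemma integral_bounds_by_antiderivative:
  fixes f g G :: "real \<Rightarrow> real"
  assumes "a \<le> b" and G: "continuous_on {a..b} G" "G a = 0"
    and "\<And>t. t \<in> {a<..<b} \<Longrightarrow> (G has_field_derivative g t) (at t)"
    and fg: "\<And>t. t \<in> {a<..<b} \<Longrightarrow> 0 \<le> f t \<and> f t \<le> g t"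
  shows "0 \<le> integral {a..b} f" "integral {a..b} f \<le> G b"
proof -
  have "(g has_integral G b - G a) {a..b}"
    using assms by (intro fundamental_theorem_of_calculus_interior)
      (auto simp flip: has_real_derivative_iff_has_vector_derivative)
  then have g: "(g has_integral G b) {a<..<b}"
    using G by (simp add: has_integral_Icc_iff_Ioo)
  have "0 \<le> integral {a<..<b} f \<and> integral {a<..<b} f \<le> G b"
  proof (cases "f integrable_on {a<..<b}")
    case True
    then have f: "(f has_integral integral {a<..<b} f) {a<..<b}"
      by (rule integrable_integral)
    show ?thesis
      using has_integral_nonneg[OF f] has_integral_le[OF f g] fg by blast
  next
    case False
    \<comment> \<open>Here the integral is 0 by convention, and both bounds persist.\<close>
    have "0 \<le> G b" using fg by (intro has_integral_nonneg[OF g]) (meson order_trans)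
    with False show ?thesis by (simp add: not_integrable_integral)
  qed
  then show "0 \<le> integral {a..b} f" "integral {a..b} f \<le> G b"
    by (simp_all add: integral_open_interval_real)
qed

text \<open>
  The assumption on growth says precisely that $2C\,e^{\beta t}t^pI_{\nu+1}(t)$ grows at least as fast as the
  integral of $e^{\beta t}t^pI_\nu(t)$; both vanish at the origin. Hence the expression in question is at most
  $2C\,xI_{\nu+1}(x)K_{\nu+1}(x)$, which is less than $C$ and tends to $0$ at the origin. Since $K_\kappa$ increases with
  $|\kappa|$, the orders $\kappa = \nu$ and $\kappa = \nu+1$ are covered together.
\<close>

lemma less_on_nonneg_bessel_K_times_integral:
  assumes \<nu>: "\<nu> > - 1/2" and p: "p = q + 1" "p + \<nu> > -1" and \<kappa>: "\<bar>\<kappa>\<bar> \<le> \<nu> + 1" and "C > 0"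
    and growth: "\<And>t. t > 0 \<Longrightarrow>
      bessel_I \<nu> t \<le> 2 * C * ((\<beta> + (p - \<nu> - 1) / t) * bessel_I (\<nu> + 1) t + bessel_I \<nu> t)"
  shows "less_on_nonneg (\<lambda>x. exp (- \<beta> * x) * bessel_K \<kappa> x / x powr q
    * integral {0..x} (\<lambda>t. exp (\<beta> * t) * t powr p * bessel_I \<nu> t)) C"
proof -
  define c where "c = 2 * C"
  have "c > 0" using \<open>C > 0\<close> by (simp add: c_def)
  note growth = growth[folded c_def]
  define f where "f x = exp (- \<beta> * x) * bessel_K \<kappa> x / x powr q
    * integral {0..x} (\<lambda>t. exp (\<beta> * t) * t powr p * bessel_I \<nu> t)" for x
  define h where "h x = c * (x * (bessel_I (\<nu> + 1) x * bessel_K_integral (\<nu> + 1) x))" for x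
  define G where "G t = c * (exp (\<beta> * t) * t powr p * bessel_I (\<nu> + 1) t)" for t
  have bound: "0 \<le> f x \<and> f x \<le> h x" if x: "x > 0" for x
  proof -
    define g where "g t = exp (\<beta> * t) * t powr p *
        (c * ((\<beta> + (p - \<nu> - 1) / t) * bessel_I (\<nu> + 1) t + bessel_I \<nu> t))" for t
    let ?f = "\<lambda>t. exp (\<beta> * t) * t powr p * bessel_I \<nu> t"
    let ?J = "integral {0..x} ?f"
    have "continuous_on {0..x} (\<lambda>t. c * exp (\<beta> * t) * t powr (p + (\<nu> + 1)) / 2 powr (\<nu> + 1)
        * bessel_E (\<nu> + 1) ((t / 2)\<^sup>2))"
      using p \<nu> by (intro continuous_intros continuous_on_powr'
          continuous_on_compose2[OF continuous_at_imp_continuous_on[of UNIV "bessel_E (\<nu> + 1)"]])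
        (auto intro: isCont_bessel_E)
    also have "?this \<longleftrightarrow> continuous_on {0..x} G"
      by (intro continuous_on_cong refl)
        (auto simp: G_def bessel_I_eq_bessel_E powr_divide powr_add)
    finally have cont: "continuous_on {0..x} G" .
    have G0: "G 0 = 0" by (simp add: G_def)
    have deriv: "(G has_field_derivative g t) (at t)" if "t \<in> {0<..<x}" for t
    proof -
      have t: "t > 0" using that by simp
      note I' = has_field_derivative_bessel_I_down[OF t, of "\<nu> + 1", simplified]
      show ?thesis
        unfolding G_def g_def
        by (rule derivative_eq_intros I' refl t)+
          (use t in \<open>auto simp: powr_diff field_simps\<close>)
    qed
    have compare: "0 \<le> ?f t \<and> ?f t \<le> g t" if "t \<in> {0<..<x}" for t
      using growth[of t] that \<nu> by (auto simp: g_def intro!: mult_left_mono mult_nonneg_nonneg bessel_I_nonneg)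
    have "0 \<le> ?J \<and> ?J \<le> G x"
      using integral_bounds_by_antiderivative[OF _ cont G0 deriv compare] x by simp
    moreover have "0 \<le> bessel_K \<kappa> x \<and> bessel_K \<kappa> x \<le> bessel_K_integral (\<nu> + 1) x"
      using x \<kappa> by (simp add: bessel_K_eq_integral bessel_K_integral_nonneg bessel_K_integral_mono_order)
    ultimately have "0 \<le> bessel_K \<kappa> x * ?J \<and> bessel_K \<kappa> x * ?J \<le> bessel_K_integral (\<nu> + 1) x * G x"
      by (auto intro: mult_mono)
    then have "0 \<le> exp (- \<beta> * x) / x powr q * (bessel_K \<kappa> x * ?J) \<and>
        exp (- \<beta> * x) / x powr q * (bessel_K \<kappa> x * ?J)
        \<le> exp (- \<beta> * x) / x powr q * (bessel_K_integral (\<nu> + 1) x * G x)"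
      by (intro conjI mult_nonneg_nonneg[of "exp (- \<beta> * x) / x powr q"]
          mult_left_mono[of _ _ "exp (- \<beta> * x) / x powr q"]) simp_all
    moreover have "exp (- \<beta> * x) / x powr q * (bessel_K_integral (\<nu> + 1) x * G x) = h x"
      using x by (simp add: G_def h_def p powr_add exp_minus field_simps)
    ultimately show ?thesis by (simp add: f_def mult_ac)
  qed
  have "f x < C" if "x > 0" for x
  proof -
    have "h x < c * (1/2)"
      unfolding h_def using \<nu> that \<open>c > 0\<close> by (intro mult_strict_left_mono bessel_IK_less_half) auto
    then show ?thesis using bound[OF that] by (simp add: c_def)
  qed
  moreover have "(f \<longlongrightarrow> 0) (at_right 0)"
  proof (rule tendsto_sandwich[OF _ _ tendsto_const])
    show "(h \<longlongrightarrow> 0) (at_right 0)"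
      unfolding h_def using \<nu> by (intro tendsto_mult_right_zero tendsto_bessel_IK_at_0) auto
  qed (auto intro!: eventually_mono[OF eventually_at_right_less] bound[THEN conjunct1] bound[THEN conjunct2])
  ultimately show ?thesis
    using \<open>C > 0\<close> unfolding less_on_nonneg_def f_def[abs_def, symmetric] by (intro conjI exI[of _ 0]) auto
qed

text \<open>
  The remaining lemmas verify the growth condition for each range of parameters. For $p = \nu+1$ the term with
  $1/t$ disappears and only $0 \le I_{\nu+1} \le I_\nu$ matters. The fraction is left
  unevaluated so that the statements match that condition literally.
\<close>

lemma bessel_I_succ_le:
  assumes "\<nu> \<ge> - 1/2" "t > 0"
  shows "(1 + (\<nu> + 1/2) / t) * bessel_I (\<nu> + 1) t \<le> bessel_I \<nu> t"
  using bessel_I_ratio[of "\<nu> + 1" t] assms by (simp add: add_ac less_imp_le)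

lemma growth_power_succ_nonneg:
  assumes "\<beta> \<ge> 0" "\<nu> > - 1/2" "t > 0"
  shows "bessel_I \<nu> t \<le> 2 * (1/2) *
    ((\<beta> + (\<nu> + 1 - \<nu> - 1) / t) * bessel_I (\<nu> + 1) t + bessel_I \<nu> t)"
  using assms bessel_I_nonneg[of "\<nu> + 1" t] by simp

lemma growth_power_succ_neg:
  assumes "- 1 < \<beta>" "\<beta> < 0" "\<nu> > - 1/2" "t > 0"
  shows "bessel_I \<nu> t \<le> 2 * (1 / (2 * (1 + \<beta>))) *
    ((\<beta> + (\<nu> + 1 - \<nu> - 1) / t) * bessel_I (\<nu> + 1) t + bessel_I \<nu> t)"
proof -
  have "1 * bessel_I (\<nu> + 1) t \<le> (1 + (\<nu> + 1/2) / t) * bessel_I (\<nu> + 1) t"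
    using assms by (intro mult_right_mono bessel_I_nonneg) auto
  also have "\<dots> \<le> bessel_I \<nu> t"
    using assms by (intro bessel_I_succ_le) auto
  finally have "\<beta> * bessel_I \<nu> t \<le> \<beta> * bessel_I (\<nu> + 1) t"
    using assms(2) by simp
  then have "(1 + \<beta>) * bessel_I \<nu> t \<le> \<beta> * bessel_I (\<nu> + 1) t + bessel_I \<nu> t"
    by (simp add: algebra_simps)
  then show ?thesis
    using assms(1) by (simp add: field_simps)
qed

text \<open>
  For $p = \nu$ the loss $-I_{\nu+1}/t$ is controlled by the recurrence
  $I_\nu = 2(\nu+1)I_{\nu+1}/t + I_{\nu+2}$ with its last term dropped.
\<close>

lemma bessel_I_succ_div_le:
  assumes "\<nu> > - 3" "t > 0"
  shows "2 * (\<nu> + 1) * (bessel_I (\<nu> + 1) t / t) \<le> bessel_I \<nu> t"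
  using bessel_I_recurrence[of t "\<nu> + 1"] bessel_I_nonneg[of "\<nu> + 2" t] assms
  by (simp add: field_simps)

lemma growth_power_nonneg:
  assumes "\<beta> \<ge> 0" "\<nu> > - 1/2" "t > 0"
  shows "bessel_I \<nu> t \<le> 2 * ((\<nu> + 1) / (2 * \<nu> + 1)) *
    ((\<beta> + (\<nu> - \<nu> - 1) / t) * bessel_I (\<nu> + 1) t + bessel_I \<nu> t)"
proof -
  define a b r where "a = bessel_I \<nu> t" and "b = bessel_I (\<nu> + 1) t" and "r = bessel_I (\<nu> + 1) t / t"
  have "2 * (\<nu> + 1) * r \<le> a"
    using bessel_I_succ_div_le[of \<nu> t] assms by (simp add: a_def r_def)
  moreover have "0 \<le> 2 * (\<nu> + 1) * (\<beta> * b)"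
    using assms by (auto simp: b_def intro!: mult_nonneg_nonneg bessel_I_nonneg)
  ultimately have "(2 * \<nu> + 1) * a \<le> 2 * (\<nu> + 1) * (\<beta> * b - r + a)"
    by (simp add: algebra_simps)
  then have "a \<le> 2 * (\<nu> + 1) * (\<beta> * b - r + a) / (2 * \<nu> + 1)"
    using assms(2) by (simp add: pos_le_divide_eq mult.commute)
  also have "\<dots> = 2 * ((\<nu> + 1) / (2 * \<nu> + 1)) * ((\<beta> + (\<nu> - \<nu> - 1) / t) * b + a)"
    by (simp add: b_def r_def algebra_simps)
  finally show ?thesis by (simp only: a_def b_def)
qed

text \<open>
  After multiplication by $1 + \beta$ the condition is affine in $\beta$. At $\beta = 0$ it is the bound from the recurrence; at $\beta = -1$ it
  becomes $(1 + 1/t)I_{\nu+1} \le I_\nu$, which the ratio bound supplies exactly when $\nu + 1/2 \ge 1$.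
\<close>

lemma growth_power_neg:
  assumes "- 1 < \<beta>" "\<beta> < 0" "\<nu> \<ge> 1/2" "t > 0"
  shows "bessel_I \<nu> t \<le> 2 * ((\<nu> + 1) / ((2 * \<nu> + 1) * (1 + \<beta>))) *
    ((\<beta> + (\<nu> - \<nu> - 1) / t) * bessel_I (\<nu> + 1) t + bessel_I \<nu> t)"
proof -
  define a b r where "a = bessel_I \<nu> t" and "b = bessel_I (\<nu> + 1) t" and "r = bessel_I (\<nu> + 1) t / t"
  have "0 \<le> a - 2 * (\<nu> + 1) * r"
    using bessel_I_succ_div_le[of \<nu> t] assms by (simp add: a_def r_def)
  then have at_0: "0 \<le> (1 + \<beta>) * (a - 2 * (\<nu> + 1) * r)"
    using assms(1) by (intro mult_nonneg_nonneg) auto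
  have "(1 + 1 / t) * b \<le> (1 + (\<nu> + 1/2) / t) * b"
    unfolding b_def using assms
    by (intro mult_right_mono bessel_I_nonneg add_left_mono divide_right_mono) auto
  also have "\<dots> \<le> a"
    unfolding a_def b_def using assms by (intro bessel_I_succ_le) auto
  finally have "0 \<le> a - b - r"
    by (simp add: b_def r_def algebra_simps)
  then have at_minus_1: "0 \<le> - \<beta> * (2 * (\<nu> + 1)) * (a - b - r)"
    using assms by (intro mult_nonneg_nonneg) auto
  have "2 * (\<nu> + 1) * (\<beta> * b - r + a) - (2 * \<nu> + 1) * (1 + \<beta>) * a
      = (1 + \<beta>) * (a - 2 * (\<nu> + 1) * r) + - \<beta> * (2 * (\<nu> + 1)) * (a - b - r)"
    by (simp add: algebra_simps)
  then have "(2 * \<nu> + 1) * (1 + \<beta>) * a \<le> 2 * (\<nu> + 1) * (\<beta> * b - r + a)"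
    using at_0 at_minus_1 by linarith
  then have "a \<le> 2 * (\<nu> + 1) * (\<beta> * b - r + a) / ((2 * \<nu> + 1) * (1 + \<beta>))"
    using assms by (simp add: pos_le_divide_eq mult_ac)
  also have "\<dots> = 2 * ((\<nu> + 1) / ((2 * \<nu> + 1) * (1 + \<beta>))) * ((\<beta> + (\<nu> - \<nu> - 1) / t) * b + a)"
    by (simp add: b_def r_def diff_divide_distrib[symmetric] left_diff_distrib)
  finally show ?thesis by (simp only: a_def b_def)
qed

theorem theorem3p2:
  fixes \<beta> \<nu> :: real
  shows "(0 \<le> \<beta> \<and> - 1 / 2 < \<nu> \<longrightarrow>
        less_on_nonneg (\<lambda>x. exp (- \<beta> * x) * bessel_K (\<nu> + 1) x / x powr \<nu>
            * integral {0..x} (\<lambda>t. exp (\<beta> * t) * t powr (\<nu> + 1) * bessel_I \<nu> t)) (1 / 2) \<and>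
        less_on_nonneg (\<lambda>x. exp (- \<beta> * x) * bessel_K \<nu> x / x powr \<nu>
            * integral {0..x} (\<lambda>t. exp (\<beta> * t) * t powr (\<nu> + 1) * bessel_I \<nu> t)) (1 / 2)) \<and>
     (0 \<le> \<beta> \<and> - 1 / 2 < \<nu> \<longrightarrow>
        less_on_nonneg (\<lambda>x. exp (- \<beta> * x) * bessel_K (\<nu> + 1) x / x powr (\<nu> - 1)
            * integral {0..x} (\<lambda>t. exp (\<beta> * t) * t powr \<nu> * bessel_I \<nu> t)) ((\<nu> + 1) / (2 * \<nu> + 1)) \<and>
        less_on_nonneg (\<lambda>x. exp (- \<beta> * x) * bessel_K \<nu> x / x powr (\<nu> - 1)
            * integral {0..x} (\<lambda>t. exp (\<beta> * t) * t powr \<nu> * bessel_I \<nu> t)) ((\<nu> + 1) / (2 * \<nu> + 1))) \<and>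
     (- 1 < \<beta> \<and> \<beta> < 0 \<and> - 1 / 2 < \<nu> \<longrightarrow>
        less_on_nonneg (\<lambda>x. exp (- \<beta> * x) * bessel_K (\<nu> + 1) x / x powr \<nu>
            * integral {0..x} (\<lambda>t. exp (\<beta> * t) * t powr (\<nu> + 1) * bessel_I \<nu> t)) (1 / (2 * (1 + \<beta>))) \<and>
        less_on_nonneg (\<lambda>x. exp (- \<beta> * x) * bessel_K \<nu> x / x powr \<nu>
            * integral {0..x} (\<lambda>t. exp (\<beta> * t) * t powr (\<nu> + 1) * bessel_I \<nu> t)) (1 / (2 * (1 + \<beta>)))) \<and>
     (- 1 < \<beta> \<and> \<beta> < 0 \<and> 1 / 2 \<le> \<nu> \<longrightarrow>
        less_on_nonneg (\<lambda>x. exp (- \<beta> * x) * bessel_K (\<nu> + 1) x / x powr (\<nu> - 1)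
            * integral {0..x} (\<lambda>t. exp (\<beta> * t) * t powr \<nu> * bessel_I \<nu> t)) ((\<nu> + 1) / ((2 * \<nu> + 1) * (1 + \<beta>))) \<and>
        less_on_nonneg (\<lambda>x. exp (- \<beta> * x) * bessel_K \<nu> x / x powr (\<nu> - 1)
            * integral {0..x} (\<lambda>t. exp (\<beta> * t) * t powr \<nu> * bessel_I \<nu> t)) ((\<nu> + 1) / ((2 * \<nu> + 1) * (1 + \<beta>))))"
  by (intro conjI impI less_on_nonneg_bessel_K_times_integral
      growth_power_succ_nonneg growth_power_nonneg growth_power_succ_neg growth_power_neg)
    auto

end
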